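(* Let $n$ be a positive integer. (i) For all units $a,b\in\mathbb{Z}/n\mathbb{Z}$, the quaternion ring $\left(\frac{a,b}{\mathbb{Z}/n\mathbb{Z}}\right)$ is isomorphic, as a ring, to $\mathbb{M}_2(\mathbb{Z}/n\mathbb{Z})$ if and only if $n$ is odd. (ii) There are at most two isomorphism classes of rings among the quaternion rings $\left(\frac{a,b}{\mathbb{Z}/n\mathbb{Z}}\right)$, with $a,b$ units of $\mathbb{Z}/n\mathbb{Z}$, and there is only one isomorphism class if and only if $n\not\equiv 0\pmod 4$.
   Context: For a commutative associative ring $R$ with identity and units $a,b\in R$, the quaternion ring (also called quaternion algebra) $\left(\frac{a,b}{R}\right)$ is the free $R$-module of rank $4$ with basis $\{1,i,j,k\}$, equipped with the associative, unital, $R$-bilinear multiplication determined by $i^2=a$, $j^2=b$, $ij=-ji=k$. $\mathbb{M}_2(R)$ denotes the ring of $2\times 2$ matrices over $R$. *)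

theory Defs
  imports "HOL-Algebra.Algebra" "HOL-Number_Theory.Cong"
begin

text \<open>
  The tuple \<open>(x0, x1, x2, x3)\<close> stands for \<open>x0 + x1 i + x2 j + x3 k\<close>. The product is the
  bilinear extension of the table forced by \<open>i\<^sup>2 = a\<close>, \<open>j\<^sup>2 = b\<close>, \<open>ij = -ji = k\<close> and
  associativity: \<open>k\<^sup>2 = -ab\<close>, \<open>ik = -ki = aj\<close>, \<open>kj = -jk = bi\<close>.
\<close>

definition quaternion_ring ::
    "('a, 'm) ring_scheme \<Rightarrow> 'a \<Rightarrow> 'a \<Rightarrow> ('a \<times> 'a \<times> 'a \<times> 'a) ring" where
  "quaternion_ring R a b =
    \<lparr>carrier = carrier R \<times> carrier R \<times> carrier R \<times> carrier R,
     monoid.mult = (\<lambda>(x0, x1, x2, x3) (y0, y1, y2, y3).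
       (x0 \<otimes>\<^bsub>R\<^esub> y0 \<oplus>\<^bsub>R\<^esub> a \<otimes>\<^bsub>R\<^esub> (x1 \<otimes>\<^bsub>R\<^esub> y1) \<oplus>\<^bsub>R\<^esub> b \<otimes>\<^bsub>R\<^esub> (x2 \<otimes>\<^bsub>R\<^esub> y2)
          \<ominus>\<^bsub>R\<^esub> (a \<otimes>\<^bsub>R\<^esub> b) \<otimes>\<^bsub>R\<^esub> (x3 \<otimes>\<^bsub>R\<^esub> y3),
        x0 \<otimes>\<^bsub>R\<^esub> y1 \<oplus>\<^bsub>R\<^esub> x1 \<otimes>\<^bsub>R\<^esub> y0 \<ominus>\<^bsub>R\<^esub> b \<otimes>\<^bsub>R\<^esub> (x2 \<otimes>\<^bsub>R\<^esub> y3) \<oplus>\<^bsub>R\<^esub> b \<otimes>\<^bsub>R\<^esub> (x3 \<otimes>\<^bsub>R\<^esub> y2),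
        x0 \<otimes>\<^bsub>R\<^esub> y2 \<oplus>\<^bsub>R\<^esub> x2 \<otimes>\<^bsub>R\<^esub> y0 \<oplus>\<^bsub>R\<^esub> a \<otimes>\<^bsub>R\<^esub> (x1 \<otimes>\<^bsub>R\<^esub> y3) \<ominus>\<^bsub>R\<^esub> a \<otimes>\<^bsub>R\<^esub> (x3 \<otimes>\<^bsub>R\<^esub> y1),
        x0 \<otimes>\<^bsub>R\<^esub> y3 \<oplus>\<^bsub>R\<^esub> x3 \<otimes>\<^bsub>R\<^esub> y0 \<oplus>\<^bsub>R\<^esub> x1 \<otimes>\<^bsub>R\<^esub> y2 \<ominus>\<^bsub>R\<^esub> x2 \<otimes>\<^bsub>R\<^esub> y1)),
     monoid.one = (\<one>\<^bsub>R\<^esub>, \<zero>\<^bsub>R\<^esub>, \<zero>\<^bsub>R\<^esub>, \<zero>\<^bsub>R\<^esub>),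
     ring.zero = (\<zero>\<^bsub>R\<^esub>, \<zero>\<^bsub>R\<^esub>, \<zero>\<^bsub>R\<^esub>, \<zero>\<^bsub>R\<^esub>),
     ring.add = (\<lambda>(x0, x1, x2, x3) (y0, y1, y2, y3).
       (x0 \<oplus>\<^bsub>R\<^esub> y0, x1 \<oplus>\<^bsub>R\<^esub> y1, x2 \<oplus>\<^bsub>R\<^esub> y2, x3 \<oplus>\<^bsub>R\<^esub> y3))\<rparr>"

definition matrix_ring ::
    "nat \<Rightarrow> ('a, 'm) ring_scheme \<Rightarrow> (nat \<times> nat \<Rightarrow> 'a) ring" where
  "matrix_ring m R =
    \<lparr>carrier = {..<m} \<times> {..<m} \<rightarrow>\<^sub>E carrier R,
     monoid.mult = (\<lambda>A B. \<lambda>(i, j) \<in> {..<m} \<times> {..<m}. \<Oplus>\<^bsub>R\<^esub>k \<in> {..<m}. A (i, k) \<otimes>\<^bsub>R\<^esub> B (k, j)),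
     monoid.one = (\<lambda>(i, j) \<in> {..<m} \<times> {..<m}. if i = j then \<one>\<^bsub>R\<^esub> else \<zero>\<^bsub>R\<^esub>),
     ring.zero = (\<lambda>(i, j) \<in> {..<m} \<times> {..<m}. \<zero>\<^bsub>R\<^esub>),
     ring.add = (\<lambda>A B. \<lambda>(i, j) \<in> {..<m} \<times> {..<m}. A (i, j) \<oplus>\<^bsub>R\<^esub> B (i, j))\<rparr>"

definition quaternion_rings ::
    "('a, 'm) ring_scheme \<Rightarrow> ('a \<times> 'a \<times> 'a \<times> 'a) ring set" where
  "quaternion_rings R = {quaternion_ring R a b | a b. a \<in> Units R \<and> b \<in> Units R}"

definition ring_iso_classes :: "'a ring set \<Rightarrow> 'a ring set set" where
  "ring_iso_classes K = K // {(S, T) \<in> K \<times> K. S \<simeq> T}"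

lemma (in cring) quaternion_ring_is_ring:
  assumes ab: "a \<in> carrier R" "b \<in> carrier R"
  shows "ring (quaternion_ring R a b)"
proof (rule ringI)
  show "abelian_group (quaternion_ring R a b)"
  proof (rule abelian_groupI)
    fix x assume x: "x \<in> carrier (quaternion_ring R a b)"
    then obtain x0 x1 x2 x3 where "x = (x0, x1, x2, x3)"
      "x0 \<in> carrier R" "x1 \<in> carrier R" "x2 \<in> carrier R" "x3 \<in> carrier R"
      by (auto simp: quaternion_ring_def)
    then show "\<exists>y \<in> carrier (quaternion_ring R a b).
        y \<oplus>\<^bsub>quaternion_ring R a b\<^esub> x = \<zero>\<^bsub>quaternion_ring R a b\<^esub>"
      by (intro bexI[of _ "(\<ominus> x0, \<ominus> x1, \<ominus> x2, \<ominus> x3)"])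
         (auto simp: quaternion_ring_def l_neg)
  qed (auto simp: quaternion_ring_def a_ac)
  show "monoid (quaternion_ring R a b)"
  proof (rule monoidI)
    fix x y z
    assume "x \<in> carrier (quaternion_ring R a b)" "y \<in> carrier (quaternion_ring R a b)"
      "z \<in> carrier (quaternion_ring R a b)"
    with ab show "x \<otimes>\<^bsub>quaternion_ring R a b\<^esub> y \<otimes>\<^bsub>quaternion_ring R a b\<^esub> z
        = x \<otimes>\<^bsub>quaternion_ring R a b\<^esub> (y \<otimes>\<^bsub>quaternion_ring R a b\<^esub> z)"
      apply (clarsimp simp: quaternion_ring_def)
      apply (simp add: minus_eq l_distr r_distr l_minus r_minus minus_add)
      apply (simp add: m_ac)
      apply (simp add: a_ac)
      done
  qed (use ab in \<open>auto simp: quaternion_ring_def minus_eq\<close>)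
next
  fix x y z
  assume "x \<in> carrier (quaternion_ring R a b)" "y \<in> carrier (quaternion_ring R a b)"
    "z \<in> carrier (quaternion_ring R a b)"
  note xyz = this
  from ab xyz show "(x \<oplus>\<^bsub>quaternion_ring R a b\<^esub> y) \<otimes>\<^bsub>quaternion_ring R a b\<^esub> z = x \<otimes>\<^bsub>quaternion_ring R a b\<^esub> z \<oplus>\<^bsub>quaternion_ring R a b\<^esub> y \<otimes>\<^bsub>quaternion_ring R a b\<^esub> z"
    apply (clarsimp simp: quaternion_ring_def)
    apply (simp add: minus_eq l_distr r_distr l_minus r_minus minus_add)
    apply (simp add: a_ac)
    done
  from ab xyz show "z \<otimes>\<^bsub>quaternion_ring R a b\<^esub> (x \<oplus>\<^bsub>quaternion_ring R a b\<^esub> y) = z \<otimes>\<^bsub>quaternion_ring R a b\<^esub> x \<oplus>\<^bsub>quaternion_ring R a b\<^esub> z \<otimes>\<^bsub>quaternion_ring R a b\<^esub> y"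
    apply (clarsimp simp: quaternion_ring_def)
    apply (simp add: minus_eq l_distr r_distr l_minus r_minus minus_add)
    apply (simp add: a_ac)
    done
qed

lemma (in cring) quaternion_ring_relations:
  assumes "a \<in> carrier R" "b \<in> carrier R"
  defines "Q \<equiv> quaternion_ring R a b"
  defines "i \<equiv> (\<zero>, \<one>, \<zero>, \<zero>)" and "j \<equiv> (\<zero>, \<zero>, \<one>, \<zero>)" and "k \<equiv> (\<zero>, \<zero>, \<zero>, \<one>)"
  shows "i \<otimes>\<^bsub>Q\<^esub> i = (a, \<zero>, \<zero>, \<zero>)" "j \<otimes>\<^bsub>Q\<^esub> j = (b, \<zero>, \<zero>, \<zero>)"
    "i \<otimes>\<^bsub>Q\<^esub> j = k" "j \<otimes>\<^bsub>Q\<^esub> i = \<ominus>\<^bsub>Q\<^esub> k"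
proof -
  interpret Q: ring Q
    unfolding Q_def using assms(1,2) by (rule quaternion_ring_is_ring)
  show "i \<otimes>\<^bsub>Q\<^esub> i = (a, \<zero>, \<zero>, \<zero>)" "j \<otimes>\<^bsub>Q\<^esub> j = (b, \<zero>, \<zero>, \<zero>)" "i \<otimes>\<^bsub>Q\<^esub> j = k"
    using assms(1,2) by (simp_all add: Q_def i_def j_def k_def quaternion_ring_def minus_eq)
  have "j \<otimes>\<^bsub>Q\<^esub> i \<oplus>\<^bsub>Q\<^esub> k = \<zero>\<^bsub>Q\<^esub>" "j \<otimes>\<^bsub>Q\<^esub> i \<in> carrier Q" "k \<in> carrier Q"
    using assms(1,2)
    by (simp_all add: Q_def i_def j_def k_def quaternion_ring_def minus_eq l_neg)
  then show "j \<otimes>\<^bsub>Q\<^esub> i = \<ominus>\<^bsub>Q\<^esub> k"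
    by (metis Q.minus_equality)
qed

end

theory Submission
  imports Defs
begin

text \<open>
  Write \<open>(a,b)\<close> for the quaternion ring over \<open>\<int>/n\<close> with units \<open>a\<close>, \<open>b\<close>. Two isomorphisms suffice for the
  classification: \<open>(a,b) \<simeq> (b,a)\<close>, by exchanging \<open>i\<close> and \<open>j\<close> (\<open>quaternion_ring_swap\<close>), and
  \<open>(a, b N) \<simeq> (a,b)\<close> for every unit \<open>N = u\<^sup>2 - a v\<^sup>2\<close>, by replacing \<open>j\<close> with \<open>(u + v i) j\<close>
  (\<open>quaternion_ring_norm\<close>). The number theory is the question which units are such norms. Modulo
  an odd prime all are, by a pigeonhole argument, and Hensel's lemma and the Chinese remainder
  theorem carry this over to odd \<open>n\<close>. For even \<open>n\<close> only the residues modulo \<open>4\<close> matter: if \<open>4\<close> divides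
  \<open>n\<close>, a unit \<open>c\<close> is a norm as soon as \<open>a\<close> or \<open>c\<close> is \<open>1\<close> modulo \<open>4\<close> (\<open>square_diff_mod\<close>). Hence \<open>(a,b)\<close> is
  isomorphic to \<open>(1,1)\<close>, unless \<open>4\<close> divides \<open>n\<close> and \<open>a = b = -1\<close> modulo \<open>4\<close>, when it is isomorphic to
  \<open>(-1,-1)\<close> (\<open>quaternion_mod_cases\<close>).

  If \<open>4\<close> divides \<open>n\<close>, the rings \<open>(1,1)\<close> and \<open>(-1,-1)\<close> differ: the former contains
  anticommuting square roots of \<open>1\<close>, namely \<open>i\<close> and \<open>j\<close>, while the latter has none even modulo \<open>4\<close>
  (\<open>quaternion_mod_not_iso\<close>).

  If \<open>n\<close> is odd, \<open>2\<close> is a unit and \<open>(1,1)\<close> is the matrix ring by an explicit isomorphism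
  (\<open>quaternion_ring_iso_matrix_ring\<close>). If \<open>n\<close> is even, no \<open>(a,b)\<close> is the matrix ring, because
  commutators of quaternions are divisible by \<open>2\<close> while the commutator of the matrix units
  \<open>E\<^sub>1\<^sub>1\<close> and \<open>E\<^sub>1\<^sub>2\<close> is \<open>E\<^sub>1\<^sub>2\<close> (\<open>quaternion_ring_iso_matrix_ring_imp_two\<close>).
\<close>

section \<open>Quaternion rings over a commutative ring\<close>

lemma carrier_quaternion_ring:
  "carrier (quaternion_ring R a b) = carrier R \<times> carrier R \<times> carrier R \<times> carrier R"
  by (simp add: quaternion_ring_def)

context cring
begin

text \<open>
  Rewriting with \<open>ring_expand\<close> proves polynomial identities in a commutative ring that contain no
  unary minus: each side becomes a single difference of sums of monomials, and the subtrahends are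
  then moved across the equation. What remains is an equation between sums of monomials without
  signs, settled by the associative-commutative laws.
\<close>
lemma diff_eq_iff:
  assumes "x \<in> carrier R" "y \<in> carrier R" "z \<in> carrier R"
  shows "x \<ominus> y = z \<longleftrightarrow> x = z \<oplus> y" "z = x \<ominus> y \<longleftrightarrow> z \<oplus> y = x"
proof -
  have "x \<ominus> y = z" if "x = z \<oplus> y"
    unfolding that minus_eq using assms by (simp add: a_assoc r_neg)
  moreover have "x = z \<oplus> y" if "x \<ominus> y = z"
    unfolding that[symmetric] minus_eq using assms by (simp add: a_assoc l_neg)
  ultimately show "x \<ominus> y = z \<longleftrightarrow> x = z \<oplus> y" "z = x \<ominus> y \<longleftrightarrow> z \<oplus> y = x" by metis+
qed

lemma diff_normalize:
  assumes "x \<in> carrier R" "y \<in> carrier R" "z \<in> carrier R"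
  shows "x \<ominus> y \<oplus> z = (x \<oplus> z) \<ominus> y" "z \<oplus> (x \<ominus> y) = (z \<oplus> x) \<ominus> y"
    "x \<ominus> y \<ominus> z = x \<ominus> (y \<oplus> z)" "z \<ominus> (x \<ominus> y) = (z \<oplus> y) \<ominus> x"
    "(x \<ominus> y) \<otimes> z = x \<otimes> z \<ominus> y \<otimes> z" "z \<otimes> (x \<ominus> y) = z \<otimes> x \<ominus> z \<otimes> y"
  using assms by (simp_all add: minus_eq minus_add l_distr r_distr l_minus r_minus a_ac)

lemmas ring_expand = diff_normalize diff_eq_iff l_distr r_distr m_ac a_ac

lemma quaternion_ring_swap:
  assumes [simp]: "a \<in> carrier R" "b \<in> carrier R"
  shows "quaternion_ring R a b \<simeq> quaternion_ring R b a"
proof -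
  \<comment> \<open>\<open>i\<close> and \<open>j\<close> are exchanged, which sends \<open>k = ij\<close> to \<open>ji = -k\<close>.\<close>
  let ?f = "\<lambda>(x0, x1, x2, x3). (x0, x2, x1, \<ominus> x3)"
  have "?f \<in> ring_iso (quaternion_ring R a b) (quaternion_ring R b a)"
  proof (rule ring_iso_memI)
    fix x y
    assume "x \<in> carrier (quaternion_ring R a b)" "y \<in> carrier (quaternion_ring R a b)"
    then obtain x0 x1 x2 x3 y0 y1 y2 y3
      where xy: "x = (x0, x1, x2, x3)" "y = (y0, y1, y2, y3)"
      and [simp]: "x0 \<in> carrier R" "x1 \<in> carrier R" "x2 \<in> carrier R" "x3 \<in> carrier R"
        "y0 \<in> carrier R" "y1 \<in> carrier R" "y2 \<in> carrier R" "y3 \<in> carrier R"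
      by (auto simp: carrier_quaternion_ring)
    show "?f (x \<otimes>\<^bsub>quaternion_ring R a b\<^esub> y)
        = ?f x \<otimes>\<^bsub>quaternion_ring R b a\<^esub> ?f y"
      unfolding xy quaternion_ring_def
      by (simp add: minus_eq l_minus r_minus minus_add m_ac a_ac)
    show "?f (x \<oplus>\<^bsub>quaternion_ring R a b\<^esub> y)
        = ?f x \<oplus>\<^bsub>quaternion_ring R b a\<^esub> ?f y"
      unfolding xy quaternion_ring_def by (simp add: minus_add)
  next
    show "bij_betw ?f (carrier (quaternion_ring R a b)) (carrier (quaternion_ring R b a))"
      by (rule bij_betw_byWitness[of _ "\<lambda>(x0, x1, x2, x3). (x0, x2, x1, \<ominus> x3)"])
        (auto simp: carrier_quaternion_ring)
  qed (auto simp: quaternion_ring_def)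
  then show ?thesis by (auto simp: is_ring_iso_def)
qed

text \<open>
  In \<open>(a,b/R)\<close> put \<open>J = u j + v k = (u + v i) j\<close>. Then \<open>iJ = -Ji\<close> and
  \<open>J\<^sup>2 = b (u\<^sup>2 - a v\<^sup>2)\<close>, and \<open>1, i, J, iJ\<close> is again a basis when the norm
  \<open>u\<^sup>2 - a v\<^sup>2\<close> of \<open>u + v i\<close> is a unit. So \<open>b\<close> may be multiplied by unit norms from \<open>R[i]\<close>.
\<close>
lemma quaternion_ring_norm:
  assumes [simp]: "a \<in> carrier R" "b \<in> carrier R" "u \<in> carrier R" "v \<in> carrier R"
    and N: "u \<otimes> u \<ominus> a \<otimes> (v \<otimes> v) \<in> Units R"
  shows "quaternion_ring R a (b \<otimes> (u \<otimes> u \<ominus> a \<otimes> (v \<otimes> v))) \<simeq> quaternion_ring R a b"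
    (is "?Q' \<simeq> ?Q")
proof -
  define N where "N = u \<otimes> u \<ominus> a \<otimes> (v \<otimes> v)"
  define w where "w = inv N"
  have [simp]: "w \<in> carrier R" and Nw: "w \<otimes> N = \<one>"
    using N by (simp_all add: w_def N_def)
  \<comment> \<open>The coordinates with respect to \<open>1, i, J, iJ\<close> are turned into those with respect to
    \<open>1, i, j, k\<close>, and back by Cramer's rule; the determinant is \<open>N\<close>.\<close>
  let ?f = "\<lambda>(x0, x1, x2, x3).
    (x0, x1, u \<otimes> x2 \<oplus> a \<otimes> v \<otimes> x3, v \<otimes> x2 \<oplus> u \<otimes> x3)"
  let ?g = "\<lambda>(x0, x1, x2, x3).
    (x0, x1, w \<otimes> (u \<otimes> x2 \<ominus> a \<otimes> v \<otimes> x3), w \<otimes> (u \<otimes> x3 \<ominus> v \<otimes> x2))"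
  have "?f \<in> ring_iso ?Q' ?Q"
  proof (rule ring_iso_memI)
    fix x y
    assume "x \<in> carrier ?Q'" "y \<in> carrier ?Q'"
    then obtain x0 x1 x2 x3 y0 y1 y2 y3
      where xy: "x = (x0, x1, x2, x3)" "y = (y0, y1, y2, y3)"
      and [simp]: "x0 \<in> carrier R" "x1 \<in> carrier R" "x2 \<in> carrier R" "x3 \<in> carrier R"
        "y0 \<in> carrier R" "y1 \<in> carrier R" "y2 \<in> carrier R" "y3 \<in> carrier R"
      by (auto simp: carrier_quaternion_ring)
    show "?f (x \<otimes>\<^bsub>?Q'\<^esub> y) = ?f x \<otimes>\<^bsub>?Q\<^esub> ?f y"
      unfolding xy quaternion_ring_def
      by (simp add: ring_expand)
    show "?f (x \<oplus>\<^bsub>?Q'\<^esub> y) = ?f x \<oplus>\<^bsub>?Q\<^esub> ?f y"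
      unfolding xy quaternion_ring_def by (simp add: ring_expand)
  next
    have cancel: "w \<otimes> (N \<otimes> x) = x" if "x \<in> carrier R" for x
      using that Nw N by (simp add: N_def flip: m_assoc)
    have
      "w \<otimes> (u \<otimes> (u \<otimes> x2 \<oplus> a \<otimes> v \<otimes> x3) \<ominus> a \<otimes> v \<otimes> (v \<otimes> x2 \<oplus> u \<otimes> x3)) = x2"
      "w \<otimes> (u \<otimes> (v \<otimes> x2 \<oplus> u \<otimes> x3) \<ominus> v \<otimes> (u \<otimes> x2 \<oplus> a \<otimes> v \<otimes> x3)) = x3"
      "u \<otimes> (w \<otimes> (u \<otimes> x2 \<ominus> a \<otimes> v \<otimes> x3)) \<oplus> a \<otimes> v \<otimes> (w \<otimes> (u \<otimes> x3 \<ominus> v \<otimes> x2)) = x2"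
      "v \<otimes> (w \<otimes> (u \<otimes> x2 \<ominus> a \<otimes> v \<otimes> x3)) \<oplus> u \<otimes> (w \<otimes> (u \<otimes> x3 \<ominus> v \<otimes> x2)) = x3"
      if [simp]: "x2 \<in> carrier R" "x3 \<in> carrier R" for x2 x3
    proof -
      have "u \<otimes> (u \<otimes> x2 \<oplus> a \<otimes> v \<otimes> x3) \<ominus> a \<otimes> v \<otimes> (v \<otimes> x2 \<oplus> u \<otimes> x3)
          = (u \<otimes> u \<ominus> a \<otimes> (v \<otimes> v)) \<otimes> x2" by (simp add: ring_expand)
      then show "w \<otimes> (u \<otimes> (u \<otimes> x2 \<oplus> a \<otimes> v \<otimes> x3) \<ominus> a \<otimes> v \<otimes> (v \<otimes> x2 \<oplus> u \<otimes> x3)) = x2"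
        using cancel[of x2] by (simp add: N_def)
      have "u \<otimes> (v \<otimes> x2 \<oplus> u \<otimes> x3) \<ominus> v \<otimes> (u \<otimes> x2 \<oplus> a \<otimes> v \<otimes> x3)
          = (u \<otimes> u \<ominus> a \<otimes> (v \<otimes> v)) \<otimes> x3" by (simp add: ring_expand)
      then show "w \<otimes> (u \<otimes> (v \<otimes> x2 \<oplus> u \<otimes> x3) \<ominus> v \<otimes> (u \<otimes> x2 \<oplus> a \<otimes> v \<otimes> x3)) = x3"
        using cancel[of x3] by (simp add: N_def)
      have "u \<otimes> (w \<otimes> (u \<otimes> x2 \<ominus> a \<otimes> v \<otimes> x3)) \<oplus> a \<otimes> v \<otimes> (w \<otimes> (u \<otimes> x3 \<ominus> v \<otimes> x2))
          = w \<otimes> ((u \<otimes> u \<ominus> a \<otimes> (v \<otimes> v)) \<otimes> x2)" by (simp add: ring_expand)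
      then show "u \<otimes> (w \<otimes> (u \<otimes> x2 \<ominus> a \<otimes> v \<otimes> x3)) \<oplus> a \<otimes> v \<otimes> (w \<otimes> (u \<otimes> x3 \<ominus> v \<otimes> x2)) = x2"
        using cancel[of x2] by (simp add: N_def)
      have "v \<otimes> (w \<otimes> (u \<otimes> x2 \<ominus> a \<otimes> v \<otimes> x3)) \<oplus> u \<otimes> (w \<otimes> (u \<otimes> x3 \<ominus> v \<otimes> x2))
          = w \<otimes> ((u \<otimes> u \<ominus> a \<otimes> (v \<otimes> v)) \<otimes> x3)" by (simp add: ring_expand)
      then show "v \<otimes> (w \<otimes> (u \<otimes> x2 \<ominus> a \<otimes> v \<otimes> x3)) \<oplus> u \<otimes> (w \<otimes> (u \<otimes> x3 \<ominus> v \<otimes> x2)) = x3"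
        using cancel[of x3] by (simp add: N_def)
    qed
    then show "bij_betw ?f (carrier ?Q') (carrier ?Q)"
      by (intro bij_betw_byWitness[of _ ?g]) (auto simp: carrier_quaternion_ring)
  qed (auto simp: quaternion_ring_def)
  then show ?thesis by (auto simp: is_ring_iso_def)
qed

text \<open>Since \<open>i\<close>, \<open>j\<close>, \<open>k\<close> pairwise anticommute, every commutator is divisible by \<open>2\<close>.\<close>
lemma quaternion_ring_commutator:
  assumes [simp]: "a \<in> carrier R" "b \<in> carrier R"
    and "x \<in> carrier (quaternion_ring R a b)" "y \<in> carrier (quaternion_ring R a b)"
  obtains z where "z \<in> carrier (quaternion_ring R a b)"
    "x \<otimes>\<^bsub>quaternion_ring R a b\<^esub> y
      = y \<otimes>\<^bsub>quaternion_ring R a b\<^esub> x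
        \<oplus>\<^bsub>quaternion_ring R a b\<^esub> (z \<oplus>\<^bsub>quaternion_ring R a b\<^esub> z)"
proof -
  obtain x0 x1 x2 x3 y0 y1 y2 y3
    where xy: "x = (x0, x1, x2, x3)" "y = (y0, y1, y2, y3)"
    and [simp]: "x0 \<in> carrier R" "x1 \<in> carrier R" "x2 \<in> carrier R" "x3 \<in> carrier R"
      "y0 \<in> carrier R" "y1 \<in> carrier R" "y2 \<in> carrier R" "y3 \<in> carrier R"
    using assms(3,4) by (auto simp: carrier_quaternion_ring)
  show ?thesis
  proof
    let ?z = "(\<zero>, b \<otimes> (x3 \<otimes> y2 \<ominus> x2 \<otimes> y3), a \<otimes> (x1 \<otimes> y3 \<ominus> x3 \<otimes> y1), x1 \<otimes> y2 \<ominus> x2 \<otimes> y1)"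
    show "?z \<in> carrier (quaternion_ring R a b)" by (simp add: carrier_quaternion_ring)
    show "x \<otimes>\<^bsub>quaternion_ring R a b\<^esub> y
      = y \<otimes>\<^bsub>quaternion_ring R a b\<^esub> x
        \<oplus>\<^bsub>quaternion_ring R a b\<^esub> (?z \<oplus>\<^bsub>quaternion_ring R a b\<^esub> ?z)"
      unfolding xy quaternion_ring_def by (simp add: ring_expand)
  qed
qed

end

section \<open>Quaternion rings and two-by-two matrices\<close>

text \<open>
  The matrix with rows \<open>(p, q)\<close> and \<open>(r, s)\<close>, as a function on index pairs that is
  \<open>undefined\<close> outside \<open>{..<2} \<times> {..<2}\<close>, as the carrier of \<^const>\<open>matrix_ring\<close> demands. The entry
  rules below write the index \<open>1\<close> as \<open>Suc 0\<close>, the simplifier's normal form.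
\<close>
definition mat2 :: "'a \<Rightarrow> 'a \<Rightarrow> 'a \<Rightarrow> 'a \<Rightarrow> nat \<times> nat \<Rightarrow> 'a" where
  "mat2 p q r s = (\<lambda>(i, j) \<in> {..<2} \<times> {..<2}.
     if i = 0 then if j = 0 then p else q else if j = 0 then r else s)"

lemma mat2_apply [simp]:
  "mat2 p q r s (0, 0) = p" "mat2 p q r s (0, Suc 0) = q"
  "mat2 p q r s (Suc 0, 0) = r" "mat2 p q r s (Suc 0, Suc 0) = s"
  by (simp_all add: mat2_def)

lemma mat2_carrier [simp]:
  assumes "p \<in> carrier R" "q \<in> carrier R" "r \<in> carrier R" "s \<in> carrier R"
  shows "mat2 p q r s \<in> carrier (matrix_ring 2 R)"
  using assms by (auto simp: mat2_def matrix_ring_def)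

lemma matrix_ring_entry:
  assumes "A \<in> carrier (matrix_ring 2 R)" "i < 2" "j < 2"
  shows "A (i, j) \<in> carrier R"
  using assms by (auto simp: matrix_ring_def)

lemma matrix_ring_eq_mat2:
  assumes "A \<in> carrier (matrix_ring 2 R)"
  shows "mat2 (A (0, 0)) (A (0, Suc 0)) (A (Suc 0, 0)) (A (Suc 0, Suc 0)) = A"
proof
  fix ij
  show "mat2 (A (0, 0)) (A (0, Suc 0)) (A (Suc 0, 0)) (A (Suc 0, Suc 0)) ij = A ij"
    using assms
    by (cases ij; cases "ij \<in> {..<2} \<times> {..<2}")
      (auto simp: mat2_def matrix_ring_def PiE_def extensional_def less_2_cases_iff)
qed

context cring
begin

lemma mat2_mult:
  assumes "p \<in> carrier R" "q \<in> carrier R" "r \<in> carrier R" "s \<in> carrier R"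
    "p' \<in> carrier R" "q' \<in> carrier R" "r' \<in> carrier R" "s' \<in> carrier R"
  shows "mat2 p q r s \<otimes>\<^bsub>matrix_ring 2 R\<^esub> mat2 p' q' r' s'
    = mat2 (p \<otimes> p' \<oplus> q \<otimes> r') (p \<otimes> q' \<oplus> q \<otimes> s') (r \<otimes> p' \<oplus> s \<otimes> r') (r \<otimes> q' \<oplus> s \<otimes> s')"
proof -
  have 2: "{..<2} = {0, Suc 0}" by auto
  have "finsum R f {..<2} = f 0 \<oplus> f (Suc 0)" if "f \<in> {0, Suc 0} \<rightarrow> carrier R" for f
    using that unfolding 2 by (subst finsum_insert) auto
  then show ?thesis
    using assms
    by (auto simp: matrix_ring_def fun_eq_iff restrict_def mat2_def less_2_cases_iff)
qed

lemma arg_cong4: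
  "a = a' \<Longrightarrow> b = b' \<Longrightarrow> c = c' \<Longrightarrow> d = d' \<Longrightarrow> f a b c d = f a' b' c' d'"
  by simp

lemma mat2_add:
  "mat2 p q r s \<oplus>\<^bsub>matrix_ring 2 R\<^esub> mat2 p' q' r' s'
    = mat2 (p \<oplus> p') (q \<oplus> q') (r \<oplus> r') (s \<oplus> s')"
  by (auto simp: matrix_ring_def fun_eq_iff restrict_def mat2_def)

lemma mat2_one: "\<one>\<^bsub>matrix_ring 2 R\<^esub> = mat2 \<one> \<zero> \<zero> \<one>"
  by (auto simp: matrix_ring_def fun_eq_iff restrict_def mat2_def less_2_cases_iff)

lemma quaternion_ring_iso_matrix_ring:
  assumes two: "\<one> \<oplus> \<one> \<in> Units R"
  shows "quaternion_ring R \<one> \<one> \<simeq> matrix_ring 2 R"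
    (is "?Q \<simeq> ?M")
proof -
  define h where "h = inv (\<one> \<oplus> \<one>)"
  have [simp]: "h \<in> carrier R" and "h \<otimes> (\<one> \<oplus> \<one>) = \<one>"
    using two by (simp_all add: h_def)
  then have half: "h \<otimes> ((\<one> \<oplus> \<one>) \<otimes> x) = x" if "x \<in> carrier R" for x
    using that by (simp flip: m_assoc)
  \<comment> \<open>\<open>i\<close> and \<open>j\<close> go to the matrices with rows \<open>(0, 1), (1, 0)\<close> and \<open>(1, 0), (0, -1)\<close>.\<close>
  let ?f = "\<lambda>(x0, x1, x2, x3). mat2 (x0 \<oplus> x2) (x1 \<ominus> x3) (x1 \<oplus> x3) (x0 \<ominus> x2)"
  let ?g = "\<lambda>A. (h \<otimes> (A (0, 0) \<oplus> A (Suc 0, Suc 0)), h \<otimes> (A (0, Suc 0) \<oplus> A (Suc 0, 0)),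
    h \<otimes> (A (0, 0) \<ominus> A (Suc 0, Suc 0)), h \<otimes> (A (Suc 0, 0) \<ominus> A (0, Suc 0)))"
  have "?f \<in> ring_iso ?Q ?M"
  proof (rule ring_iso_memI)
    fix x y
    assume "x \<in> carrier ?Q" "y \<in> carrier ?Q"
    then obtain x0 x1 x2 x3 y0 y1 y2 y3
      where xy: "x = (x0, x1, x2, x3)" "y = (y0, y1, y2, y3)"
      and [simp]: "x0 \<in> carrier R" "x1 \<in> carrier R" "x2 \<in> carrier R" "x3 \<in> carrier R"
        "y0 \<in> carrier R" "y1 \<in> carrier R" "y2 \<in> carrier R" "y3 \<in> carrier R"
      by (auto simp: carrier_quaternion_ring)
    show "?f (x \<otimes>\<^bsub>?Q\<^esub> y) = ?f x \<otimes>\<^bsub>?M\<^esub> ?f y"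
      unfolding xy quaternion_ring_def
      by (simp add: mat2_mult) (intro arg_cong4[where f = mat2]; simp add: ring_expand)
    show "?f (x \<oplus>\<^bsub>?Q\<^esub> y) = ?f x \<oplus>\<^bsub>?M\<^esub> ?f y"
      unfolding xy quaternion_ring_def
      by (simp add: mat2_add) (intro arg_cong4[where f = mat2]; simp add: ring_expand)
  next
    have "h \<otimes> ((x \<oplus> y) \<oplus> (x \<ominus> y)) = x" "h \<otimes> ((x \<oplus> y) \<ominus> (x \<ominus> y)) = y"
      "h \<otimes> ((x \<ominus> y) \<oplus> (x \<oplus> y)) = x"
      "h \<otimes> (x \<oplus> y) \<oplus> h \<otimes> (x \<ominus> y) = x" "h \<otimes> (x \<oplus> y) \<ominus> h \<otimes> (x \<ominus> y) = y"
      "h \<otimes> (y \<oplus> x) \<oplus> h \<otimes> (x \<ominus> y) = x" "h \<otimes> (y \<oplus> x) \<ominus> h \<otimes> (x \<ominus> y) = y"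
      if [simp]: "x \<in> carrier R" "y \<in> carrier R" for x y
    proof -
      have "h \<otimes> ((x \<oplus> y) \<oplus> (x \<ominus> y)) = h \<otimes> ((\<one> \<oplus> \<one>) \<otimes> x)" by (simp add: ring_expand)
      then show "h \<otimes> ((x \<oplus> y) \<oplus> (x \<ominus> y)) = x" by (simp only: half that)
      have "h \<otimes> ((x \<ominus> y) \<oplus> (x \<oplus> y)) = h \<otimes> ((\<one> \<oplus> \<one>) \<otimes> x)" by (simp add: ring_expand)
      then show "h \<otimes> ((x \<ominus> y) \<oplus> (x \<oplus> y)) = x" by (simp only: half that)
      have "h \<otimes> ((x \<oplus> y) \<ominus> (x \<ominus> y)) = h \<otimes> ((\<one> \<oplus> \<one>) \<otimes> y)" by (simp add: ring_expand)
      then show "h \<otimes> ((x \<oplus> y) \<ominus> (x \<ominus> y)) = y" by (simp only: half that)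
      have "h \<otimes> (x \<oplus> y) \<oplus> h \<otimes> (x \<ominus> y) = h \<otimes> ((\<one> \<oplus> \<one>) \<otimes> x)" by (simp add: ring_expand)
      then show "h \<otimes> (x \<oplus> y) \<oplus> h \<otimes> (x \<ominus> y) = x" by (simp only: half that)
      have "h \<otimes> (y \<oplus> x) \<oplus> h \<otimes> (x \<ominus> y) = h \<otimes> ((\<one> \<oplus> \<one>) \<otimes> x)" by (simp add: ring_expand)
      then show "h \<otimes> (y \<oplus> x) \<oplus> h \<otimes> (x \<ominus> y) = x" by (simp only: half that)
      have "h \<otimes> (x \<oplus> y) \<ominus> h \<otimes> (x \<ominus> y) = h \<otimes> ((\<one> \<oplus> \<one>) \<otimes> y)" by (simp add: ring_expand)
      then show "h \<otimes> (x \<oplus> y) \<ominus> h \<otimes> (x \<ominus> y) = y" by (simp only: half that)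
      have "h \<otimes> (y \<oplus> x) \<ominus> h \<otimes> (x \<ominus> y) = h \<otimes> ((\<one> \<oplus> \<one>) \<otimes> y)" by (simp add: ring_expand)
      then show "h \<otimes> (y \<oplus> x) \<ominus> h \<otimes> (x \<ominus> y) = y" by (simp only: half that)
    qed
    note inverse = this
    show "bij_betw ?f (carrier ?Q) (carrier ?M)"
    proof (rule bij_betw_byWitness[of _ ?g])
      show "\<forall>A \<in> carrier ?M. ?f (?g A) = A"
      proof
        fix A assume A: "A \<in> carrier ?M"
        then have "A (0, 0) \<in> carrier R" "A (0, Suc 0) \<in> carrier R"
          "A (Suc 0, 0) \<in> carrier R" "A (Suc 0, Suc 0) \<in> carrier R"
          by (auto intro: matrix_ring_entry)
        then show "?f (?g A) = A"
          using matrix_ring_eq_mat2[OF A] by (simp add: inverse)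
      qed
    qed (auto simp: carrier_quaternion_ring inverse matrix_ring_entry)
  qed (auto simp: quaternion_ring_def mat2_one minus_eq)
  then show ?thesis by (auto simp: is_ring_iso_def)
qed

text \<open>
  The matrix unit \<open>E\<^sub>1\<^sub>2 = [E\<^sub>1\<^sub>1, E\<^sub>1\<^sub>2]\<close> is a commutator. If the matrix ring is isomorphic to a
  quaternion ring, it is therefore divisible by \<open>2\<close>, and so is its entry \<open>1\<close>.
\<close>
lemma quaternion_ring_iso_matrix_ring_imp_two:
  assumes "a \<in> carrier R" "b \<in> carrier R" "quaternion_ring R a b \<simeq> matrix_ring 2 R"
  obtains z where "z \<in> carrier R" "\<one> = z \<oplus> z"
proof -
  let ?Q = "quaternion_ring R a b" and ?M = "matrix_ring 2 R"
  obtain h where h: "h \<in> ring_iso ?Q ?M" using assms(3) by (auto simp: is_ring_iso_def)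
  let ?E = "mat2 \<one> \<zero> \<zero> \<zero>" and ?F = "mat2 \<zero> \<one> \<zero> \<zero>"
  have "?E \<in> h ` carrier ?Q" "?F \<in> h ` carrier ?Q"
    using ring_iso_memE(5)[OF h] by (simp_all add: bij_betw_def)
  then obtain x y where x: "x \<in> carrier ?Q" "?E = h x" and y: "y \<in> carrier ?Q" "?F = h y"
    by (auto simp: image_iff)
  obtain z where z: "z \<in> carrier ?Q" "x \<otimes>\<^bsub>?Q\<^esub> y = y \<otimes>\<^bsub>?Q\<^esub> x \<oplus>\<^bsub>?Q\<^esub> (z \<oplus>\<^bsub>?Q\<^esub> z)"
    using quaternion_ring_commutator assms(1,2) x(1) y(1) by blast
  interpret Q: ring ?Q using assms(1,2) by (rule quaternion_ring_is_ring)
  have hz_carrier: "h z \<in> carrier ?M" using h z(1) by (rule ring_iso_memE(1))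
  obtain p q r s where hz: "h z = mat2 p q r s"
    and "p \<in> carrier R" "q \<in> carrier R" "r \<in> carrier R" "s \<in> carrier R"
    by (rule that[OF matrix_ring_eq_mat2[OF hz_carrier, symmetric]])
      (use matrix_ring_entry[OF hz_carrier] in auto)
  have "h (x \<otimes>\<^bsub>?Q\<^esub> y) = h (y \<otimes>\<^bsub>?Q\<^esub> x \<oplus>\<^bsub>?Q\<^esub> (z \<oplus>\<^bsub>?Q\<^esub> z))" using z(2) by simp
  then have "?E \<otimes>\<^bsub>?M\<^esub> ?F = ?F \<otimes>\<^bsub>?M\<^esub> ?E \<oplus>\<^bsub>?M\<^esub> (h z \<oplus>\<^bsub>?M\<^esub> h z)"
    using ring_iso_memE(2,3)[OF h] x(1) y(1) z(1) by (simp add: x(2) y(2))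
  from arg_cong[OF this, of "\<lambda>A. A (0, Suc 0)"] have "\<one> = q \<oplus> q"
    using \<open>q \<in> carrier R\<close> by (simp add: hz mat2_mult mat2_add)
  then show ?thesis using that \<open>q \<in> carrier R\<close> by blast
qed

text \<open>
  A ring isomorphic to \<open>(1,1/R)\<close> contains anticommuting square roots of \<open>1\<close>, the images of
  \<open>i\<close> and \<open>j\<close>. This is the invariant that tells \<open>(1,1/R)\<close> from \<open>(-1,-1/R)\<close>.
\<close>
lemma quaternion_ring_iso_one_one:
  assumes "ring S" "quaternion_ring R \<one> \<one> \<simeq> S"
  obtains x y where "x \<in> carrier S" "y \<in> carrier S" "x \<otimes>\<^bsub>S\<^esub> x = \<one>\<^bsub>S\<^esub>" "y \<otimes>\<^bsub>S\<^esub> y = \<one>\<^bsub>S\<^esub>"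
    "x \<otimes>\<^bsub>S\<^esub> y \<oplus>\<^bsub>S\<^esub> y \<otimes>\<^bsub>S\<^esub> x = \<zero>\<^bsub>S\<^esub>"
proof -
  let ?Q = "quaternion_ring R \<one> \<one>"
  obtain h where h: "h \<in> ring_iso ?Q S" using assms(2) by (auto simp: is_ring_iso_def)
  have Q: "ring ?Q" by (intro quaternion_ring_is_ring) simp_all
  then interpret Q: ring ?Q .
  have h0: "h \<zero>\<^bsub>?Q\<^esub> = \<zero>\<^bsub>S\<^esub>" using ring_hom_zero Q assms(1) h by (auto simp: ring_iso_def)
  define i j where "i = (\<zero>, \<one>, \<zero>, \<zero>)" and "j = (\<zero>, \<zero>, \<one>, \<zero>)"
  have ij: "i \<in> carrier ?Q" "j \<in> carrier ?Q" "i \<otimes>\<^bsub>?Q\<^esub> i = \<one>\<^bsub>?Q\<^esub>" "j \<otimes>\<^bsub>?Q\<^esub> j = \<one>\<^bsub>?Q\<^esub>"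
    "i \<otimes>\<^bsub>?Q\<^esub> j \<oplus>\<^bsub>?Q\<^esub> j \<otimes>\<^bsub>?Q\<^esub> i = \<zero>\<^bsub>?Q\<^esub>"
    by (simp_all add: i_def j_def quaternion_ring_def minus_eq r_neg)
  note hE = ring_iso_memE[OF h]
  show ?thesis
  proof
    show "h i \<otimes>\<^bsub>S\<^esub> h i = \<one>\<^bsub>S\<^esub>" "h j \<otimes>\<^bsub>S\<^esub> h j = \<one>\<^bsub>S\<^esub>"
      using hE(2,4) ij by metis+
    show "h i \<otimes>\<^bsub>S\<^esub> h j \<oplus>\<^bsub>S\<^esub> h j \<otimes>\<^bsub>S\<^esub> h i = \<zero>\<^bsub>S\<^esub>"
      using hE(2,3) ij h0 by (metis Q.m_closed)
  qed (use hE(1) ij in auto)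
qed

end

section \<open>Norms from quadratic extensions modulo n\<close>

text \<open>Hensel's lemma for \<open>e y\<^sup>2 = d\<close> modulo powers of an odd prime and of \<open>2\<close>.\<close>
lemma hensel_square_odd:
  fixes p e d x :: int
  assumes p: "Factorial_Ring.prime p" "\<not> p dvd 2 * e" and x: "\<not> p dvd x" "p dvd e * x\<^sup>2 - d"
  shows "\<exists>y. \<not> p dvd y \<and> p ^ Suc k dvd e * y\<^sup>2 - d"
proof (induction k)
  case 0
  then show ?case using x by auto
next
  case (Suc k)
  then obtain y t where y: "\<not> p dvd y" and t: "e * y\<^sup>2 - d = p ^ Suc k * t" unfolding dvd_def by blast
  have "coprime (2 * e * y) p"
    using p y by (metis coprime_commute prime_dvd_mult_iff prime_imp_coprime)
  then obtain s0 where "[2 * e * y * s0 = 1] (mod p)" using cong_solve_coprime_int by blast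
  then have "[2 * e * y * s0 * (- t) = 1 * (- t)] (mod p)" by (rule cong_scalar_right)
  then have "p dvd 2 * e * y * (s0 * (- t)) + t"
    by (simp add: cong_iff_dvd_diff algebra_simps)
  then obtain r where r: "2 * e * y * (s0 * (- t)) + t = p * r" by (auto elim: dvdE)
  \<comment> \<open>\<open>s\<close> solves \<open>2 e y s = -t\<close> modulo \<open>p\<close>, so that the error of \<open>y + p ^ Suc k * s\<close> gains a factor \<open>p\<close>.\<close>
  define s where "s = s0 * (- t)"
  let ?y = "y + p ^ Suc k * s"
  have "e * ?y\<^sup>2 - d = (e * y\<^sup>2 - d) + p ^ Suc k * (2 * e * y * s) + p ^ Suc k * (p * (e * p ^ k * s\<^sup>2))"
    by (simp add: power2_eq_square algebra_simps)
  also have "\<dots> = p ^ Suc k * (2 * e * y * s + t) + p ^ Suc k * (p * (e * p ^ k * s\<^sup>2))"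
    unfolding t by (simp add: algebra_simps)
  also have "\<dots> = p ^ Suc (Suc k) * (r + e * p ^ k * s\<^sup>2)"
    unfolding s_def r by (simp add: algebra_simps)
  finally have "p ^ Suc (Suc k) dvd e * ?y\<^sup>2 - d" by simp
  moreover have "\<not> p dvd ?y"
    using y by (simp add: dvd_add_left_iff)
  ultimately show ?case by blast
qed

lemma hensel_square_two:
  fixes e d :: int
  assumes e: "odd e" and d: "8 dvd e - d"
  shows "\<exists>y. odd y \<and> 2 ^ k dvd e * y\<^sup>2 - d"
proof -
  \<comment> \<open>The lifting step needs the square of the correction \<open>2 ^ (k + 2) * t\<close> to be negligible, so the
    induction starts at \<open>2 ^ 3\<close>, where \<open>y = 1\<close> is a solution.\<close>
  have "\<exists>y. odd y \<and> 2 ^ (k + 3) dvd e * y\<^sup>2 - d"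
  proof (induction k)
    case 0
    then show ?case using d by (intro exI[of _ 1]) auto
  next
    case (Suc k)
    then obtain y t where y: "odd y" and t: "e * y\<^sup>2 - d = 2 ^ (k + 3) * t" unfolding dvd_def by blast
    let ?y = "y + 2 ^ (k + 2) * t"
    have "e * ?y\<^sup>2 - d = (e * y\<^sup>2 - d) + 2 ^ (k + 3) * (e * y * t + 2 * (2 ^ k * e * t\<^sup>2))"
      by (simp add: power2_eq_square algebra_simps power_add)
    also have "\<dots> = 2 ^ (k + 3) * (t * (1 + e * y) + 2 * (2 ^ k * e * t\<^sup>2))"
      unfolding t by (simp add: algebra_simps)
    finally have "e * ?y\<^sup>2 - d = 2 ^ (k + 3) * (t * (1 + e * y) + 2 * (2 ^ k * e * t\<^sup>2))" .
    moreover have "2 dvd t * (1 + e * y) + 2 * (2 ^ k * e * t\<^sup>2)"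
      using e y by simp
    ultimately have "2 ^ (k + 3) * 2 dvd e * ?y\<^sup>2 - d"
      by (metis mult_dvd_mono dvd_refl)
    then have "2 ^ (Suc k + 3) dvd e * ?y\<^sup>2 - d" by (simp add: power_add mult.commute mult.left_commute)
    moreover have "odd ?y" using y by simp
    ultimately show ?case by blast
  qed
  then show ?thesis
    by (meson dvd_trans le_add1 le_imp_power_dvd)
qed

text \<open>
  The pigeonhole argument: \<open>u\<^sup>2\<close> and \<open>a v\<^sup>2 + c\<close> each take \<open>(p + 1) / 2\<close> values modulo \<open>p\<close>,
  so they share one.
\<close>
lemma square_diff_mod_prime:
  fixes p a c :: int
  assumes p: "Factorial_Ring.prime p" "p \<noteq> 2" and a: "\<not> p dvd a"
  shows "\<exists>u v. p dvd u\<^sup>2 - a * v\<^sup>2 - c"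
proof -
  define I where "I = {0..(p - 1) div 2}"
  have "p > 2" using p prime_ge_2_int[of p] by linarith
  have "odd p" using p \<open>p > 2\<close> prime_odd_int by blast
  have squares: "x = y" if "x \<in> I" "y \<in> I" "p dvd x\<^sup>2 - y\<^sup>2" for x y
  proof -
    have "p dvd (x - y) * (x + y)" using that(3) by (simp add: power2_eq_square algebra_simps)
    then consider "p dvd x - y" | "p dvd x + y" using p(1) prime_dvd_multD by blast
    then show ?thesis
    proof cases
      case 1
      then have "p dvd \<bar>x - y\<bar>" by simp
      moreover have "\<bar>x - y\<bar> < p" using that(1,2) \<open>p > 2\<close> by (auto simp: I_def)
      ultimately have "\<bar>x - y\<bar> = 0" using zdvd_imp_le[of p "\<bar>x - y\<bar>"] by linarith
      then show ?thesis by simp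
    next
      case 2
      moreover have "x + y < p" "x \<ge> 0" "y \<ge> 0" using that(1,2) \<open>p > 2\<close> by (auto simp: I_def)
      ultimately have "x + y = 0" using zdvd_imp_le[of p "x + y"] by linarith
      then show ?thesis using \<open>x \<ge> 0\<close> \<open>y \<ge> 0\<close> by linarith
    qed
  qed
  define f g where "f = (\<lambda>u. u\<^sup>2 mod p)" and "g = (\<lambda>v. (a * v\<^sup>2 + c) mod p)"
  have "inj_on f I"
    using squares by (auto simp: inj_on_def f_def mod_eq_dvd_iff)
  moreover have "inj_on g I"
  proof (rule inj_onI)
    fix x y assume xy: "x \<in> I" "y \<in> I" "g x = g y"
    then have "p dvd a * (x\<^sup>2 - y\<^sup>2)" by (simp add: g_def mod_eq_dvd_iff algebra_simps)
    then show "x = y" using squares xy a p prime_dvd_multD by blast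
  qed
  moreover obtain q where "p = 2 * q + 1" using \<open>odd p\<close> by (elim oddE)
  then have "card I + card I = nat (p + 1)" using \<open>p > 2\<close> by (simp add: I_def)
  ultimately have "card (f ` I) + card (g ` I) = nat (p + 1)" by (simp add: card_image)
  moreover have "f ` I \<union> g ` I \<subseteq> {0..<p}" using \<open>p > 2\<close> by (auto simp: f_def g_def)
  then have "card (f ` I \<union> g ` I) \<le> nat p" using card_mono[of "{0..<p}"] by fastforce
  ultimately have "card (f ` I \<union> g ` I) \<noteq> card (f ` I) + card (g ` I)" using \<open>p > 2\<close> by simp
  moreover have "finite (f ` I)" "finite (g ` I)" by (simp_all add: I_def)
  ultimately have "f ` I \<inter> g ` I \<noteq> {}" using card_Un_disjoint by blast
  then obtain u v where "f u = g v" by blast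
  then have "p dvd u\<^sup>2 - a * v\<^sup>2 - c" by (simp add: f_def g_def mod_eq_dvd_iff algebra_simps)
  then show ?thesis by blast
qed

lemma square_diff_mod_odd_prime_power:
  fixes p a c :: int
  assumes p: "Factorial_Ring.prime p" "p \<noteq> 2" and a: "\<not> p dvd a" and c: "\<not> p dvd c"
  shows "\<exists>u v. p ^ k dvd u\<^sup>2 - a * v\<^sup>2 - c"
proof -
  obtain u v where uv: "p dvd u\<^sup>2 - a * v\<^sup>2 - c"
    using square_diff_mod_prime p a by blast
  have "\<not> p dvd 2" using p prime_ge_2_int[of p] zdvd_imp_le[of p 2] by auto
  have "p ^ k dvd p ^ Suc k" by simp
  \<comment> \<open>One of \<open>u\<close>, \<open>v\<close> is a unit modulo \<open>p\<close>; it is lifted while the other one is kept.\<close>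
  consider "\<not> p dvd u" | "\<not> p dvd v"
  proof -
    have "p dvd c" if "p dvd u" "p dvd v"
    proof -
      have "p dvd u\<^sup>2 - a * v\<^sup>2" using that by (simp add: power2_eq_square)
      then have "p dvd (u\<^sup>2 - a * v\<^sup>2) - (u\<^sup>2 - a * v\<^sup>2 - c)" using uv by (rule dvd_diff)
      then show ?thesis by simp
    qed
    then show ?thesis using c that by blast
  qed
  then show ?thesis
  proof cases
    case 1
    have "p dvd 1 * u\<^sup>2 - (a * v\<^sup>2 + c)" using uv by (simp add: algebra_simps)
    then obtain y where "p ^ Suc k dvd 1 * y\<^sup>2 - (a * v\<^sup>2 + c)"
      using hensel_square_odd[of p 1 u "a * v\<^sup>2 + c" k] 1 p \<open>\<not> p dvd 2\<close> by auto
    then have "p ^ k dvd y\<^sup>2 - a * v\<^sup>2 - c"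
      using \<open>p ^ k dvd p ^ Suc k\<close> dvd_trans by (fastforce simp: algebra_simps)
    then show ?thesis by blast
  next
    case 2
    have "p dvd a * v\<^sup>2 - (u\<^sup>2 - c)" using uv by (subst dvd_diff_commute) (simp add: algebra_simps)
    then obtain y where "p ^ Suc k dvd a * y\<^sup>2 - (u\<^sup>2 - c)"
      using hensel_square_odd[of p a v "u\<^sup>2 - c" k] 2 p \<open>\<not> p dvd 2\<close> a by (auto simp: prime_dvd_mult_iff)
    then have "p ^ k dvd a * y\<^sup>2 - (u\<^sup>2 - c)" using \<open>p ^ k dvd p ^ Suc k\<close> dvd_trans by blast
    then have "p ^ k dvd u\<^sup>2 - a * y\<^sup>2 - c"
      by (subst (asm) dvd_diff_commute) (simp add: algebra_simps)
    then show ?thesis by blast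
  qed
qed

lemma odd_iff_mod_4_eq_one_or_three: "odd (c::int) \<longleftrightarrow> c mod 4 = 1 \<or> c mod 4 = 3"
  by presburger

text \<open>
  The obstruction at \<open>2\<close> sits modulo \<open>4\<close>: if \<open>a = c = 3\<close> there, then \<open>u\<^sup>2 + v\<^sup>2 = 3\<close> has no
  solution. Otherwise one of \<open>u\<close>, \<open>v\<close> can be chosen in \<open>{0, 2}\<close> so that the other one
  exists modulo \<open>8\<close> and lifts.
\<close>
lemma square_diff_mod_two_power:
  fixes a c :: int
  assumes ac: "odd a" "odd c" and "k \<ge> 2 \<Longrightarrow> [a = 1] (mod 4) \<or> [c = 1] (mod 4)"
  shows "\<exists>u v. 2 ^ k dvd u\<^sup>2 - a * v\<^sup>2 - c"
proof (cases "k \<ge> 2")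
  case False
  then have "(2::int) ^ k dvd 2" by (cases k) auto
  moreover have "2 dvd 1\<^sup>2 - a * 0\<^sup>2 - c" using ac by simp
  ultimately show ?thesis using dvd_trans by blast
next
  case True
  then have "[a = 1] (mod 4) \<or> [c = 1] (mod 4)" using assms(3) by blast
  then consider "[c = 1] (mod 4)" | "[a = 1] (mod 4)" "[c = 3] (mod 4)"
    using \<open>odd c\<close> unfolding cong_def by (auto simp: odd_iff_mod_4_eq_one_or_three)
  then show ?thesis
  proof cases
    case 1
    obtain v where "8 dvd 1 - (a * v\<^sup>2 + c)"
    proof -
      obtain q where q: "c - 1 = 4 * q" using 1 unfolding cong_iff_dvd_diff dvd_def by blast
      obtain r where r: "a = 2 * r + 1" using \<open>odd a\<close> by (elim oddE)
      show ?thesis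
      proof (cases "even q")
        case True
        then obtain l where "q = 2 * l" by (elim evenE)
        then have "1 - (a * 0\<^sup>2 + c) = 8 * (- l)" using q by simp
        then show ?thesis using that dvdI by blast
      next
        case False
        then obtain l where "q = 2 * l + 1" by (elim oddE)
        then have "1 - (a * 2\<^sup>2 + c) = 8 * (- l - r - 1)" using q r by simp
        then show ?thesis using that dvdI by blast
      qed
    qed
    then obtain u where "2 ^ k dvd 1 * u\<^sup>2 - (a * v\<^sup>2 + c)"
      using hensel_square_two[of 1] by fastforce
    then show ?thesis by (metis diff_diff_add mult_1)
  next
    case 2
    obtain u where "8 dvd a - (u\<^sup>2 - c)"
    proof -
      obtain q where q: "c - 3 = 4 * q" using 2(2) unfolding cong_iff_dvd_diff dvd_def by blast
      obtain r where r: "a - 1 = 4 * r" using 2(1) unfolding cong_iff_dvd_diff dvd_def by blast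
      show ?thesis
      proof (cases "even (q + r)")
        case True
        then obtain l where "q + r = 2 * l" by (elim evenE)
        then have "a - (2\<^sup>2 - c) = 8 * l" using q r by simp
        then show ?thesis using that dvdI by blast
      next
        case False
        then obtain l where "q + r = 2 * l + 1" by (elim oddE)
        then have "a - (0\<^sup>2 - c) = 8 * (l + 1)" using q r by simp
        then show ?thesis using that dvdI by blast
      qed
    qed
    then obtain v where "2 ^ k dvd a * v\<^sup>2 - (u\<^sup>2 - c)"
      using hensel_square_two \<open>odd a\<close> by blast
    then have "2 ^ k dvd u\<^sup>2 - a * v\<^sup>2 - c"
      by (subst (asm) dvd_diff_commute) (simp add: algebra_simps)
    then show ?thesis by blast
  qed
qed

lemma square_diff_mod_coprime_mult:
  fixes m1 m2 a c :: int
  assumes "coprime m1 m2" "m1 dvd u1\<^sup>2 - a * v1\<^sup>2 - c" "m2 dvd u2\<^sup>2 - a * v2\<^sup>2 - c"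
  shows "\<exists>u v. m1 * m2 dvd u\<^sup>2 - a * v\<^sup>2 - c"
proof -
  obtain u where u: "[u = u1] (mod m1)" "[u = u2] (mod m2)"
    using binary_chinese_remainder_int[OF assms(1)] by blast
  obtain v where v: "[v = v1] (mod m1)" "[v = v2] (mod m2)"
    using binary_chinese_remainder_int[OF assms(1)] by blast
  have "[u\<^sup>2 - a * v\<^sup>2 - c = u1\<^sup>2 - a * v1\<^sup>2 - c] (mod m1)"
    "[u\<^sup>2 - a * v\<^sup>2 - c = u2\<^sup>2 - a * v2\<^sup>2 - c] (mod m2)"
    using u v by (auto intro!: cong_diff cong_mult cong_pow)
  then have "m1 dvd u\<^sup>2 - a * v\<^sup>2 - c" "m2 dvd u\<^sup>2 - a * v\<^sup>2 - c"
    using assms(2,3) by (simp_all add: cong_dvd_iff)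
  then show ?thesis using assms(1) divides_mult by blast
qed

text \<open>Every unit \<open>c\<close> modulo \<open>n\<close> is a norm \<open>u\<^sup>2 - a v\<^sup>2\<close>, up to the obstruction modulo \<open>4\<close>.\<close>
lemma square_diff_mod:
  fixes n a c :: int
  assumes "n > 0" "coprime a n" "coprime c n"
    and "4 dvd n \<Longrightarrow> [a = 1] (mod 4) \<or> [c = 1] (mod 4)"
  shows "\<exists>u v. n dvd u\<^sup>2 - a * v\<^sup>2 - c"
  using assms
proof (induction "nat n" arbitrary: n rule: less_induct)
  case less
  show ?case
  proof (cases "n = 1")
    case False
    then obtain p where p: "Factorial_Ring.prime p" "p dvd n"
      using less.prems(1) prime_factor_int[of n] by auto
    then have "p > 1" using prime_gt_1_int by blast
    obtain m where m: "n = p ^ multiplicity p n * m" "\<not> p dvd m"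
      using multiplicity_decompose'[of n p] p less.prems(1) by (metis not_prime_unit less_numeral_extra(3))
    define k where "k = multiplicity p n"
    have n: "n = p ^ k * m" using m(1) by (simp add: k_def)
    have "k > 0" using p m(2) n by (cases k) auto
    have "m > 0" using less.prems(1) n \<open>p > 1\<close> by (simp add: zero_less_mult_iff)
    moreover have "p ^ k > 1" using \<open>k > 0\<close> \<open>p > 1\<close> by simp
    ultimately have "m < n" using n by simp
    have "\<exists>u v. m dvd u\<^sup>2 - a * v\<^sup>2 - c"
      using less.prems n \<open>m > 0\<close> \<open>m < n\<close> by (intro less.hyps) auto
    moreover have "\<not> p dvd a" "\<not> p dvd c"
      using less.prems p by (meson coprime_common_divisor not_prime_unit)+
    have "\<exists>u v. p ^ k dvd u\<^sup>2 - a * v\<^sup>2 - c"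
    proof (cases "p = 2")
      case True
      have "4 dvd n" if "k \<ge> 2"
        using n True le_imp_power_dvd[OF that, of "2::int"] by auto
      then show ?thesis
        using square_diff_mod_two_power[of a c k] less.prems(4) True \<open>\<not> p dvd a\<close> \<open>\<not> p dvd c\<close> by simp
    qed (use square_diff_mod_odd_prime_power p \<open>\<not> p dvd a\<close> \<open>\<not> p dvd c\<close> in blast)
    moreover have "coprime (p ^ k) m"
      using p(1) m(2) by (simp add: prime_imp_coprime)
    ultimately show ?thesis
      unfolding n using square_diff_mod_coprime_mult by blast
  qed auto
qed

section \<open>Integers modulo n\<close>

lemma ZMod_ring_hom: "ZMod n \<in> ring_hom \<Z> (ZFact n)"
proof -
  have "ideal (Idl\<^bsub>\<Z>\<^esub> {n}) \<Z>" by (rule int.genideal_ideal) simp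
  from ideal.rcos_ring_hom[OF this] show ?thesis
    unfolding ZFact_def ZMod_def .
qed

lemma ZMod_carrier [simp]: "ZMod n x \<in> carrier (ZFact n)"
  using ring_hom_closed[OF ZMod_ring_hom] by simp

lemma ZMod_mult: "ZMod n x \<otimes>\<^bsub>ZFact n\<^esub> ZMod n y = ZMod n (x * y)"
  using ring_hom_mult[OF ZMod_ring_hom, of x y n] by simp

lemma ZMod_add: "ZMod n x \<oplus>\<^bsub>ZFact n\<^esub> ZMod n y = ZMod n (x + y)"
  using ring_hom_add[OF ZMod_ring_hom, of x y n] by simp

lemma ZMod_one: "\<one>\<^bsub>ZFact n\<^esub> = ZMod n 1"
  using ring_hom_one[OF ZMod_ring_hom, of n] by simp

lemma ZMod_zero: "\<zero>\<^bsub>ZFact n\<^esub> = ZMod n 0"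
  using ring_hom_zero[OF ZMod_ring_hom, of n] cring.axioms(1)[OF ZFact_is_cring]
    cring.axioms(1)[OF int_is_cring] by simp

lemma ZMod_minus: "ZMod n x \<ominus>\<^bsub>ZFact n\<^esub> ZMod n y = ZMod n (x - y)"
proof -
  interpret cring "ZFact n" by (rule ZFact_is_cring)
  have "\<ominus>\<^bsub>ZFact n\<^esub> ZMod n y = ZMod n (- y)"
    by (rule minus_equality) (simp_all add: ZMod_add ZMod_zero)
  then show ?thesis by (simp add: minus_eq ZMod_add)
qed

lemma ZMod_eq_iff_dvd: "ZMod n x = ZMod n y \<longleftrightarrow> n dvd x - y"
  by (simp add: ZMod_eq_mod mod_eq_dvd_iff)

lemma ZMod_surj:
  assumes "A \<in> carrier (ZFact n)"
  obtains x where "A = ZMod n x"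
  using assms by (auto simp: ZFact_defs A_RCOSETS_def' ZMod_def)

lemma ZMod_Units_iff: "ZMod n a \<in> Units (ZFact n) \<longleftrightarrow> coprime a n"
proof
  assume "ZMod n a \<in> Units (ZFact n)"
  then obtain B where "B \<in> carrier (ZFact n)" "ZMod n a \<otimes>\<^bsub>ZFact n\<^esub> B = \<one>\<^bsub>ZFact n\<^esub>"
    by (auto simp: Units_def)
  then obtain b where "[a * b = 1] (mod n)"
    by (metis ZMod_surj ZMod_mult ZMod_one ZMod_eq_mod cong_def)
  then show "coprime a n" using coprime_iff_invertible_int by blast
next
  assume "coprime a n"
  then obtain b where "[a * b = 1] (mod n)" using coprime_iff_invertible_int by blast
  then have "ZMod n a \<otimes>\<^bsub>ZFact n\<^esub> ZMod n b = \<one>\<^bsub>ZFact n\<^esub>"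
    by (simp add: ZMod_mult ZMod_one ZMod_eq_mod cong_def)
  moreover from this have "ZMod n b \<otimes>\<^bsub>ZFact n\<^esub> ZMod n a = \<one>\<^bsub>ZFact n\<^esub>"
    by (simp add: ZMod_mult mult.commute)
  ultimately show "ZMod n a \<in> Units (ZFact n)"
    unfolding Units_def using ZMod_carrier by blast
qed

section \<open>Quaternion rings over the integers modulo n\<close>

text \<open>
  The quaternion ring over \<open>\<int>/n\<close> with parameters given by integer representatives. It is defined
  for all integers \<open>a\<close>, \<open>b\<close>; the coprimality that makes them units is assumed where needed.
\<close>
definition quaternion_mod :: "int \<Rightarrow> int \<Rightarrow> int \<Rightarrow> (int set \<times> int set \<times> int set \<times> int set) ring" where
  "quaternion_mod n a b = quaternion_ring (ZFact n) (ZMod n a) (ZMod n b)"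

declare ring_iso_trans [trans]

lemma quaternion_mod_ring: "ring (quaternion_mod n a b)"
  unfolding quaternion_mod_def
  by (intro cring.quaternion_ring_is_ring ZFact_is_cring) simp_all

lemma quaternion_mod_swap: "quaternion_mod n a b \<simeq> quaternion_mod n b a"
  unfolding quaternion_mod_def
  by (intro cring.quaternion_ring_swap ZFact_is_cring) simp_all

text \<open>
  The quotient \<open>c = b / b'\<close> is a norm \<open>u\<^sup>2 - a v\<^sup>2\<close> modulo \<open>n\<close>; the condition modulo \<open>4\<close> says that
  \<open>a = 1\<close> or \<open>c = 1\<close> there.
\<close>
lemma quaternion_mod_change:
  assumes n: "n > 0" and ab: "coprime a n" "coprime b n" "coprime b' n"
    and 4: "4 dvd n \<Longrightarrow> [a = 1] (mod 4) \<or> [b = b'] (mod 4)"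
  shows "quaternion_mod n a b \<simeq> quaternion_mod n a b'"
proof -
  interpret cring "ZFact n" by (rule ZFact_is_cring)
  obtain d where d: "[b' * d = 1] (mod n)" using ab coprime_iff_invertible_int by blast
  define c where "c = d * b"
  have "[b' * d * b = 1 * b] (mod n)" using d by (rule cong_scalar_right)
  then have c: "[b' * c = b] (mod n)" by (simp add: c_def mult.assoc)
  have "coprime d n"
    using d coprime_iff_invertible_int by (metis mult.commute)
  then have "coprime c n" using ab by (simp add: c_def)
  have "[a = 1] (mod 4) \<or> [c = 1] (mod 4)" if "4 dvd n"
  proof -
    have "[c = 1] (mod 4)" if "[b = b'] (mod 4)"
    proof -
      have "[d * b' = 1] (mod 4)"
        using d \<open>4 dvd n\<close> by (metis cong_dvd_modulus mult.commute)
      moreover have "[c = d * b'] (mod 4)" unfolding c_def using that by (rule cong_scalar_left)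
      ultimately show ?thesis using cong_trans by blast
    qed
    then show ?thesis using 4 that by blast
  qed
  then obtain u v where uv: "n dvd u\<^sup>2 - a * v\<^sup>2 - c"
    using square_diff_mod[of n a c] n ab(1) \<open>coprime c n\<close> by blast
  have norm: "ZMod n u \<otimes>\<^bsub>ZFact n\<^esub> ZMod n u \<ominus>\<^bsub>ZFact n\<^esub> ZMod n a \<otimes>\<^bsub>ZFact n\<^esub> (ZMod n v \<otimes>\<^bsub>ZFact n\<^esub> ZMod n v)
      = ZMod n c"
    using uv by (simp add: ZMod_mult ZMod_minus ZMod_eq_iff_dvd monoid_mult_class.power2_eq_square)
  have "ZMod n b' \<otimes>\<^bsub>ZFact n\<^esub> ZMod n c = ZMod n b"
    using c by (simp add: ZMod_mult ZMod_eq_mod cong_def)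
  then show ?thesis
    using quaternion_ring_norm[of "ZMod n a" "ZMod n b'" "ZMod n u" "ZMod n v"] \<open>coprime c n\<close>
    by (simp add: norm ZMod_Units_iff quaternion_mod_def)
qed

lemma quaternion_mod_split:
  assumes n: "n > 0" and ab: "coprime a n" "coprime b n" and 4: "4 dvd n \<Longrightarrow> [a = 1] (mod 4)"
  shows "quaternion_mod n a b \<simeq> quaternion_mod n 1 1"
proof -
  have "quaternion_mod n a b \<simeq> quaternion_mod n a 1"
    using n ab 4 by (intro quaternion_mod_change) auto
  also have "quaternion_mod n a 1 \<simeq> quaternion_mod n 1 a" by (rule quaternion_mod_swap)
  also have "quaternion_mod n 1 a \<simeq> quaternion_mod n 1 1"
    using n ab by (intro quaternion_mod_change) auto
  finally show ?thesis .
qed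

lemma odd_cong_1_or_minus_1_mod_4: "odd (c::int) \<Longrightarrow> [c = 1] (mod 4) \<or> [c = - 1] (mod 4)"
  unfolding cong_def by (auto simp: odd_iff_mod_4_eq_one_or_three)

lemma quaternion_mod_cases:
  assumes n: "n > 0" and ab: "coprime a n" "coprime b n"
  shows "quaternion_mod n a b \<simeq> quaternion_mod n 1 1
    \<or> 4 dvd n \<and> quaternion_mod n a b \<simeq> quaternion_mod n (- 1) (- 1)"
proof -
  consider "\<not> 4 dvd n \<or> [a = 1] (mod 4)" | "[b = 1] (mod 4)"
    | "4 dvd n" "[a = - 1] (mod 4)" "[b = - 1] (mod 4)"
  proof -
    have "odd a" "odd b" if "4 dvd n"
    proof -
      have "even n" using that by presburger
      then show "odd a" "odd b" using ab by (meson coprime_common_divisor odd_one)+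
    qed
    then show ?thesis using that odd_cong_1_or_minus_1_mod_4 by blast
  qed
  then show ?thesis
  proof cases
    case 1
    then show ?thesis using quaternion_mod_split n ab by blast
  next
    case 2
    then have "quaternion_mod n b a \<simeq> quaternion_mod n 1 1" using quaternion_mod_split n ab by blast
    then show ?thesis using quaternion_mod_swap ring_iso_trans by blast
  next
    case 3
    have "quaternion_mod n a b \<simeq> quaternion_mod n a (- 1)"
      using n ab 3 by (intro quaternion_mod_change) auto
    also have "quaternion_mod n a (- 1) \<simeq> quaternion_mod n (- 1) a" by (rule quaternion_mod_swap)
    also have "quaternion_mod n (- 1) a \<simeq> quaternion_mod n (- 1) (- 1)"
      using n ab 3 by (intro quaternion_mod_change) auto
    finally show ?thesis using 3 by blast
  qed
qed

lemma square_mod_4: "(x::int)\<^sup>2 mod 4 = (if even x then 0 else 1)"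
proof (cases "even x")
  case True
  then obtain y where "x = 2 * y" by (elim evenE)
  then show ?thesis by (simp add: power2_eq_square)
next
  case False
  then obtain y where "x = 2 * y + 1" by (elim oddE)
  then have "x\<^sup>2 = 1 + 4 * (y * y + y)" by (simp add: power2_eq_square algebra_simps)
  then have "x\<^sup>2 mod 4 = 1" by (simp only: mod_mult_self2) simp
  then show ?thesis using False by simp
qed

text \<open>
  The hypotheses say that \<open>x = x0 + x1 i + x2 j + x3 k\<close> and likewise \<open>y\<close> satisfy \<open>x\<^sup>2 = y\<^sup>2 = 1\<close> and
  \<open>xy + yx = 0\<close> in \<open>(-1,-1)\<close> modulo \<open>4\<close>, with a common factor \<open>2\<close> cancelled wherever all terms
  have one. If \<open>x0\<close> and \<open>y0\<close> are even, then \<open>x\<^sup>2 = 1\<close> makes a sum of three squares \<open>3\<close> modulo \<open>4\<close>, so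
  all other coordinates are odd and the real part of \<open>xy + yx\<close> is an odd multiple of \<open>2\<close>. If \<open>x0\<close>
  is odd, then \<open>x1\<close>, \<open>x2\<close>, \<open>x3\<close> are even, \<open>xy + yx = 0\<close> makes all coordinates of \<open>y\<close> even, and
  \<open>y\<^sup>2 = 1\<close> fails; the same holds with \<open>x\<close> and \<open>y\<close> exchanged.
\<close>
lemma no_anticommuting_involutions_mod_4:
  fixes x0 x1 x2 x3 y0 y1 y2 y3 :: int
  assumes x: "[x0\<^sup>2 - x1\<^sup>2 - x2\<^sup>2 - x3\<^sup>2 = 1] (mod 4)"
    and y: "[y0\<^sup>2 - y1\<^sup>2 - y2\<^sup>2 - y3\<^sup>2 = 1] (mod 4)"
    and xx: "even (x0 * x1)" "even (x0 * x2)" "even (x0 * x3)"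
    and yy: "even (y0 * y1)" "even (y0 * y2)" "even (y0 * y3)"
    and xy: "even (x0 * y0 - x1 * y1 - x2 * y2 - x3 * y3)"
      "even (x0 * y1 + x1 * y0)" "even (x0 * y2 + x2 * y0)" "even (x0 * y3 + x3 * y0)"
  shows False
proof -
  have *: "odd z0 \<or> odd z1 \<and> odd z2 \<and> odd z3"
    if "[z0\<^sup>2 - z1\<^sup>2 - z2\<^sup>2 - z3\<^sup>2 = 1] (mod 4)" for z0 z1 z2 z3 :: int
  proof -
    have "(z0\<^sup>2 mod 4 - z1\<^sup>2 mod 4 - z2\<^sup>2 mod 4 - z3\<^sup>2 mod 4) mod 4 = 1"
    proof -
      have "[z0\<^sup>2 mod 4 - z1\<^sup>2 mod 4 - z2\<^sup>2 mod 4 - z3\<^sup>2 mod 4 = z0\<^sup>2 - z1\<^sup>2 - z2\<^sup>2 - z3\<^sup>2] (mod 4)"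
        by (intro cong_diff) (simp_all add: cong_def)
      with that show ?thesis using cong_trans by (force simp: cong_def)
    qed
    then show ?thesis unfolding square_mod_4 by (auto split: if_splits)
  qed
  show False using *[OF x] *[OF y] xx yy xy by auto
qed

lemma quaternion_mod_mult:
  "(ZMod n x0, ZMod n x1, ZMod n x2, ZMod n x3) \<otimes>\<^bsub>quaternion_mod n a b\<^esub>
      (ZMod n y0, ZMod n y1, ZMod n y2, ZMod n y3)
    = (ZMod n (x0 * y0 + a * (x1 * y1) + b * (x2 * y2) - (a * b) * (x3 * y3)),
       ZMod n (x0 * y1 + x1 * y0 - b * (x2 * y3) + b * (x3 * y2)),
       ZMod n (x0 * y2 + x2 * y0 + a * (x1 * y3) - a * (x3 * y1)),
       ZMod n (x0 * y3 + x3 * y0 + x1 * y2 - x2 * y1))"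
  by (simp add: quaternion_mod_def quaternion_ring_def ZMod_mult ZMod_add ZMod_minus)

lemma quaternion_mod_not_iso:
  assumes "4 dvd n"
  shows "\<not> quaternion_mod n 1 1 \<simeq> quaternion_mod n (- 1) (- 1)"
proof
  let ?H = "quaternion_mod n (- 1) (- 1)"
  assume iso: "quaternion_mod n 1 1 \<simeq> ?H"
  obtain x y where xy: "x \<in> carrier ?H" "y \<in> carrier ?H"
      "x \<otimes>\<^bsub>?H\<^esub> x = \<one>\<^bsub>?H\<^esub>" "y \<otimes>\<^bsub>?H\<^esub> y = \<one>\<^bsub>?H\<^esub>" "x \<otimes>\<^bsub>?H\<^esub> y \<oplus>\<^bsub>?H\<^esub> y \<otimes>\<^bsub>?H\<^esub> x = \<zero>\<^bsub>?H\<^esub>"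
    using cring.quaternion_ring_iso_one_one[OF ZFact_is_cring quaternion_mod_ring] iso
    unfolding quaternion_mod_def ZMod_one by metis
  have carrier: "carrier ?H = carrier (ZFact n) \<times> carrier (ZFact n) \<times> carrier (ZFact n) \<times> carrier (ZFact n)"
    by (simp add: quaternion_mod_def carrier_quaternion_ring)
  obtain x0 x1 x2 x3 where x: "x = (ZMod n x0, ZMod n x1, ZMod n x2, ZMod n x3)"
    using xy(1) unfolding carrier by (auto elim!: ZMod_surj)
  obtain y0 y1 y2 y3 where y: "y = (ZMod n y0, ZMod n y1, ZMod n y2, ZMod n y3)"
    using xy(2) unfolding carrier by (auto elim!: ZMod_surj)
  have one: "\<one>\<^bsub>?H\<^esub> = (ZMod n 1, ZMod n 0, ZMod n 0, ZMod n 0)"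
    by (simp add: quaternion_mod_def quaternion_ring_def ZMod_one ZMod_zero)
  have zero: "\<zero>\<^bsub>?H\<^esub> = (ZMod n 0, ZMod n 0, ZMod n 0, ZMod n 0)"
    by (simp add: quaternion_mod_def quaternion_ring_def ZMod_zero)
  have add: "(ZMod n p0, ZMod n p1, ZMod n p2, ZMod n p3) \<oplus>\<^bsub>?H\<^esub> (ZMod n q0, ZMod n q1, ZMod n q2, ZMod n q3)
      = (ZMod n (p0 + q0), ZMod n (p1 + q1), ZMod n (p2 + q2), ZMod n (p3 + q3))"
    for p0 p1 p2 p3 q0 q1 q2 q3
    by (simp add: quaternion_mod_def quaternion_ring_def ZMod_add)
  have eq4: "4 dvd p - q" if "ZMod n p = ZMod n q" for p q
    using that assms dvd_trans ZMod_eq_iff_dvd by blast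
  have even: "even p" if "4 dvd 2 * p" for p :: int
    using that by presburger
  have sq: "[z0\<^sup>2 - z1\<^sup>2 - z2\<^sup>2 - z3\<^sup>2 = 1] (mod 4)"
      "even (z0 * z1)" "even (z0 * z2)" "even (z0 * z3)"
    if "z \<otimes>\<^bsub>?H\<^esub> z = \<one>\<^bsub>?H\<^esub>" "z = (ZMod n z0, ZMod n z1, ZMod n z2, ZMod n z3)"
    for z z0 z1 z2 z3
  proof -
    note eqs = that(1)[unfolded that(2) quaternion_mod_mult one prod.inject]
    note z = eqs[THEN conjunct1, THEN eq4]
      eqs[THEN conjunct2, THEN conjunct1, THEN eq4]
      eqs[THEN conjunct2, THEN conjunct2, THEN conjunct1, THEN eq4]
      eqs[THEN conjunct2, THEN conjunct2, THEN conjunct2, THEN eq4]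
    show "[z0\<^sup>2 - z1\<^sup>2 - z2\<^sup>2 - z3\<^sup>2 = 1] (mod 4)"
      using z(1) by (simp add: cong_iff_dvd_diff power2_eq_square)
    have "4 dvd 2 * (z0 * z1)" "4 dvd 2 * (z0 * z2)" "4 dvd 2 * (z0 * z3)"
      using z(2-4) by (simp_all add: algebra_simps)
    then show "even (z0 * z1)" "even (z0 * z2)" "even (z0 * z3)" by (blast intro: even)+
  qed
  have "x \<otimes>\<^bsub>?H\<^esub> y \<oplus>\<^bsub>?H\<^esub> y \<otimes>\<^bsub>?H\<^esub> x =
      (ZMod n (2 * (x0 * y0 - x1 * y1 - x2 * y2 - x3 * y3)), ZMod n (2 * (x0 * y1 + x1 * y0)),
       ZMod n (2 * (x0 * y2 + x2 * y0)), ZMod n (2 * (x0 * y3 + x3 * y0)))"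
    unfolding x y quaternion_mod_mult add by (simp add: algebra_simps)
  then have "4 dvd 2 * (x0 * y0 - x1 * y1 - x2 * y2 - x3 * y3)" "4 dvd 2 * (x0 * y1 + x1 * y0)"
      "4 dvd 2 * (x0 * y2 + x2 * y0)" "4 dvd 2 * (x0 * y3 + x3 * y0)"
    unfolding xy(5) zero prod.inject using eq4[of 0] by (auto dest: eq4)
  from this[THEN even] sq[OF xy(3) x] sq[OF xy(4) y] show False
    using no_anticommuting_involutions_mod_4[of x0 x1 x2 x3 y0 y1 y2 y3] by blast
qed

lemma equiv_ring_iso:
  assumes "\<And>S. S \<in> K \<Longrightarrow> ring S"
  shows "equiv K {(S, T) \<in> K \<times> K. S \<simeq> T}"
proof (rule equivI)
  show "refl_on K {(S, T) \<in> K \<times> K. S \<simeq> T}"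
    using ring_iso_refl by (auto simp: refl_on_def)
  show "sym {(S, T) \<in> K \<times> K. S \<simeq> T}"
    using assms ring_iso_sym by (auto simp: sym_def)
  show "trans {(S, T) \<in> K \<times> K. S \<simeq> T}"
    by (rule transI) (auto intro: ring_iso_trans)
qed auto

theorem mainTheorem3:
  fixes n :: nat
  assumes "n > 0"
  shows "(\<forall>a \<in> Units (ZFact (int n)). \<forall>b \<in> Units (ZFact (int n)).
            quaternion_ring (ZFact (int n)) a b \<simeq> matrix_ring 2 (ZFact (int n)) \<longleftrightarrow> odd n)
       \<and> finite (ring_iso_classes (quaternion_rings (ZFact (int n))))
       \<and> card (ring_iso_classes (quaternion_rings (ZFact (int n)))) \<le> 2
       \<and> (card (ring_iso_classes (quaternion_rings (ZFact (int n)))) = 1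
            \<longleftrightarrow> \<not> [n = 0] (mod 4))"
proof -
  interpret cring "ZFact (int n)" by (rule ZFact_is_cring)
  let ?R = "ZFact (int n)"
  let ?K = "quaternion_rings ?R"
  let ?H = "quaternion_mod (int n)"
  have n: "int n > 0" using assms by simp
  have unit: "\<exists>x. A = ZMod (int n) x \<and> coprime x (int n)" if "A \<in> Units ?R" for A
  proof -
    have "A \<in> carrier ?R" using that by (rule Units_closed)
    then obtain x where "A = ZMod (int n) x" by (rule ZMod_surj)
    then show ?thesis using that by (auto simp: ZMod_Units_iff)
  qed
  have matrix: "quaternion_ring ?R a b \<simeq> matrix_ring 2 ?R \<longleftrightarrow> odd n"
    if ab: "a \<in> Units ?R" "b \<in> Units ?R" for a b
  proof
    assume "quaternion_ring ?R a b \<simeq> matrix_ring 2 ?R"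
    then obtain C where "C \<in> carrier ?R" "\<one>\<^bsub>?R\<^esub> = C \<oplus>\<^bsub>?R\<^esub> C"
      using quaternion_ring_iso_matrix_ring_imp_two ab by blast
    then obtain z where "int n dvd 1 - (z + z)"
      by (metis ZMod_surj ZMod_one ZMod_add ZMod_eq_iff_dvd)
    moreover have "odd (1 - (z + z))" by simp
    ultimately show "odd n" by (meson dvd_trans even_of_nat_iff)
  next
    assume "odd n"
    then have "coprime 2 (int n)" by simp
    then have "\<one>\<^bsub>?R\<^esub> \<oplus>\<^bsub>?R\<^esub> \<one>\<^bsub>?R\<^esub> \<in> Units ?R" by (simp add: ZMod_one ZMod_add ZMod_Units_iff)
    then have "?H 1 1 \<simeq> matrix_ring 2 ?R"
      using quaternion_ring_iso_matrix_ring unfolding quaternion_mod_def ZMod_one by blast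
    moreover have "\<not> 4 dvd int n" using \<open>odd n\<close> by presburger
    then have "quaternion_ring ?R a b \<simeq> ?H 1 1"
      using unit[OF ab(1)] unit[OF ab(2)] quaternion_mod_split[OF n]
      unfolding quaternion_mod_def by blast
    ultimately show "quaternion_ring ?R a b \<simeq> matrix_ring 2 ?R" using ring_iso_trans by blast
  qed
  have K: "\<exists>a b. S = ?H a b \<and> coprime a (int n) \<and> coprime b (int n)" if "S \<in> ?K" for S
  proof -
    obtain A B where "S = quaternion_ring ?R A B" "A \<in> Units ?R" "B \<in> Units ?R"
      using \<open>S \<in> ?K\<close> unfolding quaternion_rings_def by blast
    then show ?thesis using unit[of A] unit[of B] unfolding quaternion_mod_def by blast
  qed
  define r where "r = {(S, T) \<in> ?K \<times> ?K. S \<simeq> T}"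
  have "equiv ?K r"
    unfolding r_def using K quaternion_mod_ring by (intro equiv_ring_iso) blast
  have H: "?H a b \<in> ?K" if "coprime a (int n)" "coprime b (int n)" for a b
    using that ZMod_Units_iff unfolding quaternion_rings_def quaternion_mod_def by blast
  have H1: "?H 1 1 \<in> ?K" and H2: "?H (- 1) (- 1) \<in> ?K" by (rule H; simp)+
  have same_class: "r `` {S} = r `` {T} \<longleftrightarrow> S \<simeq> T" if "S \<in> ?K" "T \<in> ?K" for S T
    using eq_equiv_class_iff[OF \<open>equiv ?K r\<close> that] that by (simp add: r_def)
  have classes: "ring_iso_classes ?K = {r `` {?H 1 1}, r `` {?H (- 1) (- 1)}}"
  proof -
    have "r `` {S} \<in> {r `` {?H 1 1}, r `` {?H (- 1) (- 1)}}" if "S \<in> ?K" for S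
    proof -
      have "S \<simeq> ?H 1 1 \<or> S \<simeq> ?H (- 1) (- 1)" using K[OF that] quaternion_mod_cases[OF n] by blast
      then show ?thesis using same_class H1 H2 that by blast
    qed
    then have "(\<lambda>S. r `` {S}) ` ?K \<subseteq> {r `` {?H 1 1}, r `` {?H (- 1) (- 1)}}"
      by (rule image_subsetI)
    moreover have "{r `` {?H 1 1}, r `` {?H (- 1) (- 1)}} \<subseteq> (\<lambda>S. r `` {S}) ` ?K"
      by (intro insert_subsetI empty_subsetI imageI H1 H2)
    moreover have "ring_iso_classes ?K = (\<lambda>S. r `` {S}) ` ?K"
      unfolding ring_iso_classes_def r_def quotient_def by blast
    ultimately show ?thesis by (simp only: subset_antisym)
  qed
  have "?H 1 1 \<simeq> ?H (- 1) (- 1) \<longleftrightarrow> \<not> 4 dvd int n"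
  proof
    assume "\<not> 4 dvd int n"
    then have "?H (- 1) (- 1) \<simeq> ?H 1 1" using quaternion_mod_cases[OF n, of "- 1" "- 1"] by auto
    then show "?H 1 1 \<simeq> ?H (- 1) (- 1)" using ring_iso_sym quaternion_mod_ring by blast
  qed (use quaternion_mod_not_iso in blast)
  moreover have "4 dvd int n \<longleftrightarrow> [n = 0] (mod 4)" unfolding cong_def by presburger
  ultimately have "r `` {?H 1 1} = r `` {?H (- 1) (- 1)} \<longleftrightarrow> \<not> [n = 0] (mod 4)"
    using same_class[OF H1 H2] by simp
  then have "card (ring_iso_classes ?K) = 1 \<longleftrightarrow> \<not> [n = 0] (mod 4)" "card (ring_iso_classes ?K) \<le> 2"
    "finite (ring_iso_classes ?K)"
    unfolding classes by (auto simp: card_insert_if)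
  then show ?thesis using matrix by blast
qed

end
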